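(* Let $v,w\in S_n$. Then $w$ covers $v$ in the middle order $\mathcal{P}_n$ if and only if there are positions $a<b$ with $v(a)<v(b)$ such that no position $c$ with $a<c<b$ satisfies $v(c)<v(b)$, and $w$ is obtained from $v$ by swapping the entries in positions $a$ and $b$. (Equivalently: $v$ and $w$ differ exactly by an occurrence in $v$ of the mesh pattern with underlying pattern $12$ and shaded region consisting of the points strictly between the two pattern entries horizontally and below the larger entry, becoming an occurrence in $w$ of the mesh pattern with underlying pattern $21$ with the same shaded region.)
   Context: Permutations are written in one-line notation $w=w(1)\cdots w(n)$. For $w\in S_n$, its inversion sequence is $I(w)=(x_1,\ldots,x_n)$ with $x_i=\#\{j<i : w^{-1}(j)>w^{-1}(i)\}$. The middle order $\mathcal{P}_n$ is the poset on $S_n$ with $v\le w$ if and only if $I(v)\le I(w)$ coordinate-wise. A mesh pattern $(p,M)$ with $p\in S_k$ and $M$ a set of unit squares of $[0,k+1]^2$ is contained in $w$ if there is an occurrence of $p$ in $w$ such that the regions of the plot of $w$ corresponding to the shaded squares contain no points of the plot $\{(i,w(i))\}$. *)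

theory Defs
  imports "HOL-Combinatorics.Permutations" "HOL-Combinatorics.Transposition"
begin

text \<open>A permutation in \<open>S\<^sub>n\<close> is a function \<open>w :: nat \<Rightarrow> nat\<close> with
  \<open>w permutes {1..n}\<close>; its one-line notation is \<open>w 1, \<dots>, w n\<close>.\<close>

definition sym_perms :: "nat \<Rightarrow> (nat \<Rightarrow> nat) set" where
  "sym_perms n = {w. w permutes {1..n}}"

definition inversion_seq :: "(nat \<Rightarrow> nat) \<Rightarrow> nat \<Rightarrow> nat" where
  "inversion_seq w i = card {j \<in> {1..<i}. inv w j > inv w i}"

definition middle_le :: "nat \<Rightarrow> (nat \<Rightarrow> nat) \<Rightarrow> (nat \<Rightarrow> nat) \<Rightarrow> bool" where
  "middle_le n v w \<longleftrightarrow> (\<forall>i\<in>{1..n}. inversion_seq v i \<le> inversion_seq w i)"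

definition covers_in :: "'a set \<Rightarrow> ('a \<Rightarrow> 'a \<Rightarrow> bool) \<Rightarrow> 'a \<Rightarrow> 'a \<Rightarrow> bool" where
  "covers_in P le y x \<longleftrightarrow>
     x \<in> P \<and> y \<in> P \<and> le x y \<and> x \<noteq> y \<and>
     \<not> (\<exists>z\<in>P. le x z \<and> le z y \<and> z \<noteq> x \<and> z \<noteq> y)"

definition middle_covers :: "nat \<Rightarrow> (nat \<Rightarrow> nat) \<Rightarrow> (nat \<Rightarrow> nat) \<Rightarrow> bool" where
  "middle_covers n w v \<longleftrightarrow> covers_in (sym_perms n) (middle_le n) w v"

text \<open>An occurrence of \<open>p \<in> S\<^sub>k\<close> in \<open>w \<in> S\<^sub>n\<close> is given by its positions
  \<open>f 1 < \<dots> < f k\<close>; values of \<open>f\<close> outside \<open>{1..k}\<close> are irrelevant.\<close>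

definition pattern_occurrence ::
  "nat \<Rightarrow> (nat \<Rightarrow> nat) \<Rightarrow> nat \<Rightarrow> (nat \<Rightarrow> nat) \<Rightarrow> (nat \<Rightarrow> nat) \<Rightarrow> bool" where
  "pattern_occurrence k p n w f \<longleftrightarrow>
     strict_mono_on {1..k} f \<and> f ` {1..k} \<subseteq> {1..n} \<and>
     (\<forall>s\<in>{1..k}. \<forall>t\<in>{1..k}. w (f s) < w (f t) \<longleftrightarrow> p s < p t)"

text \<open>The grid lines cut out by an occurrence: \<open>0\<close>, then \<open>g 1, \<dots>, g k\<close>, then \<open>n + 1\<close>.\<close>

definition grid_line :: "nat \<Rightarrow> nat \<Rightarrow> (nat \<Rightarrow> nat) \<Rightarrow> nat \<Rightarrow> nat" where
  "grid_line k n g i = (if i = 0 then 0 else if i \<le> k then g i else n + 1)"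

text \<open>The unit square \<open>[i, i + 1] \<times> [j, j + 1]\<close> is encoded by its lower left corner \<open>(i, j)\<close>,
  so a shading \<open>M\<close> is a subset of \<open>{0..k} \<times> {0..k}\<close>. The \<open>j\<close>-th smallest value of the
  occurrence \<open>f\<close> of \<open>p\<close> in \<open>w\<close> is \<open>w (f (inv p j))\<close>.\<close>

definition mesh_occurrence ::
  "nat \<Rightarrow> (nat \<Rightarrow> nat) \<Rightarrow> (nat \<times> nat) set \<Rightarrow> nat \<Rightarrow> (nat \<Rightarrow> nat) \<Rightarrow> (nat \<Rightarrow> nat) \<Rightarrow> bool" where
  "mesh_occurrence k p M n w f \<longleftrightarrow>
     pattern_occurrence k p n w f \<and>
     (\<forall>(i, j)\<in>M. \<not> (\<exists>c\<in>{1..n}.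
        grid_line k n f i < c \<and> c < grid_line k n f (i + 1) \<and>
        grid_line k n (\<lambda>t. w (f (inv p t))) j < w c \<and>
        w c < grid_line k n (\<lambda>t. w (f (inv p t))) (j + 1)))"

definition perm12 :: "nat \<Rightarrow> nat" where
  "perm12 = id"

definition perm21 :: "nat \<Rightarrow> nat" where
  "perm21 = transpose 1 2"

definition middle_shading :: "(nat \<times> nat) set" where
  "middle_shading = {(1, 0), (1, 1)}"

end

theory Submission
  imports Defs
begin

text \<open>Swapping an occurrence of the mesh pattern 12 raises the inversion sequence by one at the larger
  of the two values and changes nothing else. An inversion sequence determines its permutation, so
  such a swap is a cover. Conversely, if \<open>v < w\<close> then the sequence of \<open>v\<close> is smaller than that of
  \<open>w\<close> at some \<open>i\<close>, so in \<open>v\<close> some smaller value precedes \<open>i\<close>; swapping \<open>i\<close> with the nearest such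
  value produces an element above \<open>v\<close> and below \<open>w\<close>, which must be \<open>w\<close> if \<open>w\<close> covers \<open>v\<close>.\<close>

section \<open>Effect of a swap on the inversion sequence\<close>

lemma inversion_seq_swap:
  fixes v :: "nat \<Rightarrow> nat"
  assumes "bij v" and "a < b" and "v a < v b" and "1 \<le> v a"
    and gap: "\<And>c. a < c \<Longrightarrow> c < b \<Longrightarrow> v b \<le> v c"
  shows "inversion_seq (v \<circ> transpose a b) i = (if i = v b then Suc (inversion_seq v i) else inversion_seq v i)"
proof -
  define q where "q = inv v"
  have qv [simp]: "q (v c) = c" and vq [simp]: "v (q j) = j" for c j
    using \<open>bij v\<close> by (simp_all add: q_def bij_is_inj bij_is_surj surj_f_inv_f)
  have inv_swap: "inv (v \<circ> transpose a b) j = transpose a b (q j)" for j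
    using \<open>bij v\<close> by (simp add: q_def o_inv_distrib)
  have qa: "q j = a \<longleftrightarrow> j = v a" and qb: "q j = b \<longleftrightarrow> j = v b" for j
    using qv vq by metis+
  have gap': "q j \<le> a \<or> b \<le> q j" if "j < v b" for j
    using gap[of "q j"] that by fastforce
  define S where "S = {j \<in> {1..<i}. q i < q j}"
  define T where "T = {j \<in> {1..<i}. transpose a b (q i) < transpose a b (q j)}"
  have S: "inversion_seq v i = card S" and T: "inversion_seq (v \<circ> transpose a b) i = card T"
    by (simp_all add: inversion_seq_def S_def T_def q_def [symmetric] inv_swap)
  consider "i < v b" | "i = v b" | "i > v b" by linarith
  then show ?thesis
  proof cases
    case 1
    \<comment> \<open>Among the values up to \<open>i\<close>, all below \<open>v b\<close>, only
      \<open>v a\<close> can move. It goes from \<open>a\<close> to \<open>b\<close>, and by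
      \<open>gap'\<close> it passes none of the others.\<close>
    have "transpose a b (q i) < transpose a b (q j) \<longleftrightarrow> q i < q j" if "j < i" for j
      using gap'[of i] gap'[of j] qa[of i] qa[of j] qb[of i] qb[of j] 1 that \<open>a < b\<close>
      by (auto simp: transpose_def)
    then have "T = S" by (auto simp: S_def T_def)
    then show ?thesis using 1 S T by simp
  next
    case 2
    \<comment> \<open>The value \<open>v b\<close> moves left past \<open>v a\<close> and past no
      other smaller value, so exactly one inversion is created. The bound \<open>1 \<le> v a\<close>
      puts it in the counted range.\<close>
    have "transpose a b (q i) < transpose a b (q j) \<longleftrightarrow> j = v a \<or> q i < q j" if "j < i" for j
      using gap'[of j] qa[of j] qb[of j] 2 that \<open>a < b\<close> by (auto simp: transpose_def)
    then have "T = insert (v a) S"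
      using 2 \<open>v a < v b\<close> \<open>1 \<le> v a\<close> by (auto simp: S_def T_def)
    moreover have "v a \<notin> S" "finite S" using 2 \<open>a < b\<close> by (auto simp: S_def)
    ultimately show ?thesis using 2 S T by simp
  next
    case 3
    \<comment> \<open>Swapping the positions \<open>a\<close> and \<open>b\<close> amounts to
      swapping the values \<open>v a\<close> and \<open>v b\<close>. Both lie below
      \<open>i\<close>, so the counted values are merely renamed.\<close>
    define s where "s = transpose (v a) (v b)"
    have qs: "transpose a b (q j) = q (s j)" for j
      using qa[of j] qb[of j] by (auto simp: s_def transpose_def)
    have "s i = i" using 3 \<open>v a < v b\<close> by (auto simp: s_def transpose_def)
    moreover have "s j \<in> {1..<i} \<longleftrightarrow> j \<in> {1..<i}" for j
      using 3 \<open>v a < v b\<close> \<open>1 \<le> v a\<close> by (auto simp: s_def transpose_def)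
    ultimately have "T = s -` S" by (auto simp: S_def T_def qs)
    moreover have "bij s" by (simp add: s_def)
    ultimately have "card T = card S"
      by (simp add: bij_is_inj bij_is_surj card_vimage_inj)
    then show ?thesis using 3 S T by simp
  qed
qed

section \<open>Recovering a permutation from its inversion sequence\<close>

text \<open>Up-sets of a total preorder are nested, so finite ones are told apart by their size. It
  is applied to the sets of values standing to the right of a given value.\<close>

lemma up_sets_eq:
  fixes q :: "'a \<Rightarrow> 'b::linorder"
  assumes "finite A" "U \<subseteq> A" "V \<subseteq> A" "card U = card V"
    and "\<And>x y. x \<in> U \<Longrightarrow> y \<in> A \<Longrightarrow> q x \<le> q y \<Longrightarrow> y \<in> U"
    and "\<And>x y. x \<in> V \<Longrightarrow> y \<in> A \<Longrightarrow> q x \<le> q y \<Longrightarrow> y \<in> V"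
  shows "U = V"
proof -
  have "U \<subseteq> V \<or> V \<subseteq> U"
    using assms(2,3,5,6) by (meson linear subset_iff)
  then show ?thesis
    using assms(1-4) by (metis card_subset_eq finite_subset)
qed

text \<open>Build the permutation by inserting the values in increasing order. Entry
  \<open>m + 1\<close> counts the smaller values to the right of \<open>m + 1\<close>, and this
  number fixes its place among the values already arranged.\<close>

lemma inversion_seq_relative_order:
  fixes v w :: "nat \<Rightarrow> nat"
  assumes "bij v" "bij w" "\<And>i. i \<in> {1..m} \<Longrightarrow> inversion_seq v i = inversion_seq w i"
  shows "\<forall>j\<in>{1..m}. \<forall>k\<in>{1..m}. inv v j < inv v k \<longleftrightarrow> inv w j < inv w k"
  using assms(3)
proof (induction m)
  case 0
  then show ?case by simp
next
  case (Suc m)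
  define q r where "q = inv v" and "r = inv w"
  have inj: "q j = q k \<longleftrightarrow> j = k" "r j = r k \<longleftrightarrow> j = k" for j k
    using assms(1,2) by (simp_all add: q_def r_def bij_imp_bij_inv bij_is_inj inj_eq)
  have IH: "q j < q k \<longleftrightarrow> r j < r k" if "j \<in> {1..m}" "k \<in> {1..m}" for j k
    using Suc that by (simp add: q_def r_def)
  have IH': "q j \<le> q k \<longleftrightarrow> r j \<le> r k" if "j \<in> {1..m}" "k \<in> {1..m}" for j k
    using IH[OF that(2,1)] by (simp add: not_less[symmetric])
  define U V where "U = {j \<in> {1..m}. q (Suc m) < q j}" and "V = {j \<in> {1..m}. r (Suc m) < r j}"
  have "card U = card V"
    using Suc.prems[of "Suc m"]
    by (simp add: inversion_seq_def U_def V_def q_def r_def atLeastLessThanSuc_atLeastAtMost)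
  then have "U = V"
  proof (intro up_sets_eq[where A = "{1..m}" and q = q])
    \<comment> \<open>\<open>V\<close> is defined through \<open>r\<close>; the induction hypothesis
      makes it an up-set for \<open>q\<close> too, so that both sets are compared in one
      order.\<close>
    fix x y assume "x \<in> V" "y \<in> {1..m}" "q x \<le> q y"
    then show "y \<in> V" using IH'[of x y] by (auto simp: V_def)
  qed (auto simp: U_def V_def)
  then have new: "q (Suc m) < q j \<longleftrightarrow> r (Suc m) < r j" if "j \<in> {1..m}" for j
    using that by (auto simp: U_def V_def)
  have new': "q j < q (Suc m) \<longleftrightarrow> r j < r (Suc m)" if "j \<in> {1..m}" for j
    using new[OF that] inj[of j "Suc m"] that by (metis Suc_n_not_le_n atLeastAtMost_iff not_less_iff_gr_or_eq)
  show ?case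
    unfolding q_def[symmetric] r_def[symmetric]
    using IH new new' by (simp add: atLeastAtMostSuc_conv)
qed

text \<open>As \<open>p\<close> maps onto an initial segment of the positive integers, each value is
  its own rank. This turns equality of relative orders into equality of permutations.\<close>

lemma permutes_eq_card:
  assumes "p permutes {1..n::nat}" "k \<in> {1..n}"
  shows "p k = card {j \<in> {1..n}. p j \<le> p k}"
proof -
  have "p k \<in> {1..n}" using permutes_in_image[OF assms(1)] assms(2) by simp
  have "p ` {j \<in> {1..n}. p j \<le> p k} = {i \<in> p ` {1..n}. i \<le> p k}" by blast
  also have "\<dots> = {1..p k}"
    using \<open>p k \<in> {1..n}\<close> by (subst permutes_image[OF assms(1)]) auto
  finally have "p ` {j \<in> {1..n}. p j \<le> p k} = {1..p k}" .
  moreover have "inj_on p {j \<in> {1..n}. p j \<le> p k}"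
    using permutes_inj[OF assms(1)] inj_on_subset by blast
  ultimately show ?thesis by (metis card_atLeastAtMost card_image diff_Suc_1)
qed

text \<open>The inverses have the same relative order on \<open>{1..n}\<close>, hence the same
  ranks, hence the same values.\<close>

lemma inversion_seq_inject:
  assumes "v permutes {1..n}" "w permutes {1..n}"
    and "\<And>i. i \<in> {1..n} \<Longrightarrow> inversion_seq v i = inversion_seq w i"
  shows "v = w"
proof -
  have order: "inv v j \<le> inv v k \<longleftrightarrow> inv w j \<le> inv w k" if "j \<in> {1..n}" "k \<in> {1..n}" for j k
    using inversion_seq_relative_order[of v w n] assms that by (meson not_le permutes_bij)
  have perms: "inv v permutes {1..n}" "inv w permutes {1..n}"
    using assms permutes_inv by blast+
  have "inv v = inv w"
  proof
    fix k
    show "inv v k = inv w k"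
    proof (cases "k \<in> {1..n}")
      case True
      then have "{j \<in> {1..n}. inv v j \<le> inv v k} = {j \<in> {1..n}. inv w j \<le> inv w k}"
        using order by blast
      then show ?thesis
        using permutes_eq_card[OF perms(1) True] permutes_eq_card[OF perms(2) True] by simp
    next
      case False
      then show ?thesis using perms by (simp add: permutes_not_in)
    qed
  qed
  then show ?thesis using assms by (metis permutes_inv_inv)
qed

section \<open>Covers as swaps of positions\<close>

text \<open>The mesh pattern 12 in terms of positions. The two shaded squares merge into
  \<open>v c < v b\<close>, since for a permutation no \<open>c\<close> strictly between takes the
  value \<open>v a\<close>.\<close>

definition middle_swap :: "nat \<Rightarrow> (nat \<Rightarrow> nat) \<Rightarrow> nat \<Rightarrow> nat \<Rightarrow> bool" where
  "middle_swap n v a b \<longleftrightarrow> a \<in> {1..n} \<and> b \<in> {1..n} \<and> a < b \<and> v a < v b \<and>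
     \<not> (\<exists>c. a < c \<and> c < b \<and> v c < v b)"

lemma middle_swap_permutes:
  assumes "v permutes {1..n}" "middle_swap n v a b"
  shows "(v \<circ> transpose a b) permutes {1..n}"
  using assms by (auto simp: middle_swap_def intro!: permutes_compose permutes_swap_id)

lemma middle_swap_neq: "middle_swap n v a b \<Longrightarrow> v \<circ> transpose a b \<noteq> v"
  by (metis comp_apply middle_swap_def nat_neq_iff transpose_apply_second)

lemma middle_swap_inversion_seq:
  assumes "v permutes {1..n}" "middle_swap n v a b"
  shows "inversion_seq (v \<circ> transpose a b) i = (if i = v b then Suc (inversion_seq v i) else inversion_seq v i)"
proof (rule inversion_seq_swap)
  show "1 \<le> v a" using assms permutes_in_image[OF assms(1), of a] by (auto simp: middle_swap_def)
  show "v b \<le> v c" if "a < c" "c < b" for c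
    using assms(2) that by (meson middle_swap_def not_le)
qed (use assms in \<open>auto simp: middle_swap_def permutes_bij\<close>)

text \<open>The entry at \<open>i\<close> is \<open>i - 1\<close> exactly when every smaller value
  stands to the right of \<open>i\<close>. Otherwise some smaller value stands to the left, and the
  nearest one gives the swap.\<close>

lemma ex_middle_swap:
  assumes v: "v permutes {1..n}" and i: "i \<in> {1..n}" and less: "inversion_seq v i < i - 1"
  obtains a b where "middle_swap n v a b" "v b = i"
proof -
  define b where "b = inv v i"
  have b: "v b = i" "b \<in> {1..n}"
    using v i permutes_in_image[OF permutes_inv[OF v]] by (auto simp: b_def permutes_inverses)
  obtain j where j: "j \<in> {1..<i}" "inv v j \<le> b"
  proof -
    have "{j \<in> {1..<i}. b < inv v j} \<noteq> {1..<i}"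
    proof
      assume "{j \<in> {1..<i}. b < inv v j} = {1..<i}"
      then show False using less by (simp add: inversion_seq_def b_def)
    qed
    then show thesis using that by fastforce
  qed
  \<comment> \<open>The maximum of \<open>C\<close> is the nearest position to the left of
    \<open>b\<close> holding a smaller value, so no such value lies between it and
    \<open>b\<close>.\<close>
  define C where "C = {c \<in> {1..<b}. v c < i}"
  have "inv v j \<in> {1..n}" "v (inv v j) = j"
    using v i j permutes_in_image[OF permutes_inv[OF v], of j] by (auto simp: permutes_inverses)
  moreover from this have "inv v j \<noteq> b" using j b by auto
  ultimately have "inv v j \<in> C" using j by (auto simp: C_def)
  moreover have fin: "finite C" by (simp add: C_def)
  ultimately have max: "Max C \<in> C" using Max_in by blast
  have "\<not> (\<exists>c. Max C < c \<and> c < b \<and> v c < i)"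
  proof
    assume "\<exists>c. Max C < c \<and> c < b \<and> v c < i"
    then obtain c where "Max C < c" "c < b" "v c < i" by blast
    then have "c \<in> C" by (auto simp: C_def)
    then show False using \<open>Max C < c\<close> Max_ge[OF fin] by fastforce
  qed
  moreover have "Max C \<in> {1..n}" "Max C < b" "v (Max C) < i" using max b(2) by (simp_all add: C_def)
  ultimately have "middle_swap n v (Max C) b" using b by (simp add: middle_swap_def)
  then show thesis using that b by blast
qed

lemma inversion_seq_le: "inversion_seq w i \<le> i - 1"
proof -
  have "card {j \<in> {1..<i}. inv w j > inv w i} \<le> card {1..<i}" by (rule card_mono) auto
  then show ?thesis by (simp add: inversion_seq_def)
qed

lemma middle_covers_iff_swap:
  assumes v: "v permutes {1..n}" and w: "w permutes {1..n}"
  shows "middle_covers n w v \<longleftrightarrow> (\<exists>a b. middle_swap n v a b \<and> w = v \<circ> transpose a b)"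
proof
  assume cov: "middle_covers n w v"
  then have le: "\<And>i. i \<in> {1..n} \<Longrightarrow> inversion_seq v i \<le> inversion_seq w i" and "v \<noteq> w"
    by (auto simp: middle_covers_def covers_in_def middle_le_def)
  then obtain i where i: "i \<in> {1..n}" "inversion_seq v i < inversion_seq w i"
    using inversion_seq_inject[OF v w] by (meson order.order_iff_strict)
  \<comment> \<open>The entry of \<open>w\<close> at \<open>i\<close> is at most
    \<open>i - 1\<close>, so that of \<open>v\<close> is strictly below this bound.\<close>
  then obtain a b where ab: "middle_swap n v a b" "v b = i"
    using ex_middle_swap[OF v] inversion_seq_le[of w i] by (metis order_less_le_trans)
  define z where "z = v \<circ> transpose a b"
  have seq: "inversion_seq z k = (if k = i then Suc (inversion_seq v k) else inversion_seq v k)" for k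
    using middle_swap_inversion_seq[OF v ab(1)] ab(2) by (simp add: z_def)
  have "z \<in> sym_perms n" "z \<noteq> v"
    using middle_swap_permutes[OF v ab(1)] middle_swap_neq[OF ab(1)] by (auto simp: z_def sym_perms_def)
  \<comment> \<open>The swap raises only entry \<open>i\<close>, by one, and there \<open>w\<close>
    exceeds \<open>v\<close> by at least one.\<close>
  moreover have "middle_le n v z" "middle_le n z w"
    using le i seq by (auto simp: middle_le_def)
  ultimately have "z = w"
    using cov by (auto simp: middle_covers_def covers_in_def)
  then show "\<exists>a b. middle_swap n v a b \<and> w = v \<circ> transpose a b" using ab z_def by blast
next
  assume "\<exists>a b. middle_swap n v a b \<and> w = v \<circ> transpose a b"
  then obtain a b where ab: "middle_swap n v a b" "w = v \<circ> transpose a b" by blast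
  have seq: "inversion_seq w k = (if k = v b then Suc (inversion_seq v k) else inversion_seq v k)" for k
    using middle_swap_inversion_seq[OF v ab(1)] ab(2) by simp
  \<comment> \<open>The sequences of \<open>v\<close> and \<open>w\<close> differ only at
    \<open>v b\<close>, by one, so the entry of \<open>z\<close> there decides which of the two it
    equals.\<close>
  have "z = v \<or> z = w" if "z \<in> sym_perms n" "middle_le n v z" "middle_le n z w" for z
  proof -
    have z: "z permutes {1..n}" using that by (simp add: sym_perms_def)
    have sq: "inversion_seq v k \<le> inversion_seq z k" "inversion_seq z k \<le> inversion_seq w k"
      if "k \<in> {1..n}" for k using \<open>middle_le n v z\<close> \<open>middle_le n z w\<close> that by (auto simp: middle_le_def)
    show ?thesis
    proof (cases "inversion_seq z (v b) \<le> inversion_seq v (v b)")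
      case True
      have "inversion_seq z k = inversion_seq v k" if "k \<in> {1..n}" for k
        using sq[OF that] seq[of k] True by (auto split: if_splits)
      then show ?thesis using inversion_seq_inject[OF z v] by blast
    next
      case False
      have "inversion_seq z k = inversion_seq w k" if "k \<in> {1..n}" for k
        using sq[OF that] seq[of k] False by (auto split: if_splits)
      then show ?thesis using inversion_seq_inject[OF z w] by blast
    qed
  qed
  moreover have "middle_le n v w" using seq by (simp add: middle_le_def)
  ultimately show "middle_covers n w v"
    using v w middle_swap_neq[OF ab(1)] ab(2)
    by (auto simp: middle_covers_def covers_in_def sym_perms_def)
qed

section \<open>Mesh patterns of length two\<close>

lemma pattern_occurrence_2_iff:
  "pattern_occurrence 2 perm12 n v f \<longleftrightarrow>
     f 1 \<in> {1..n} \<and> f 2 \<in> {1..n} \<and> f 1 < f 2 \<and> v (f 1) < v (f 2)"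
  "pattern_occurrence 2 perm21 n v f \<longleftrightarrow>
     f 1 \<in> {1..n} \<and> f 2 \<in> {1..n} \<and> f 1 < f 2 \<and> v (f 2) < v (f 1)"
proof -
  have two: "{1..2::nat} = {1, 2}" by (simp add: numeral_2_eq_2 atLeastAtMostSuc_conv insert_commute)
  have mono: "strict_mono_on {1, 2} f \<longleftrightarrow> f 1 < f 2"
    unfolding strict_mono_on_def by (auto; metis One_nat_def lessI numeral_2_eq_2)
  show "pattern_occurrence 2 perm12 n v f \<longleftrightarrow>
      f 1 \<in> {1..n} \<and> f 2 \<in> {1..n} \<and> f 1 < f 2 \<and> v (f 1) < v (f 2)"
    "pattern_occurrence 2 perm21 n v f \<longleftrightarrow>
      f 1 \<in> {1..n} \<and> f 2 \<in> {1..n} \<and> f 1 < f 2 \<and> v (f 2) < v (f 1)"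
    unfolding pattern_occurrence_def two mono
    by (simp_all add: perm12_def perm21_def) auto
qed

lemma mesh_occurrence_perm12_iff:
  assumes v: "v permutes {1..n}"
  shows "mesh_occurrence 2 perm12 middle_shading n v f \<longleftrightarrow> middle_swap n v (f 1) (f 2)"
proof -
  have pos: "0 < v c" if "c \<in> {1..n}" for c
    using permutes_in_image[OF v, of c] that by auto
  have inj: "v c = v d \<longleftrightarrow> c = d" for c d using permutes_inj[OF v] by (simp add: inj_eq)
  have "mesh_occurrence 2 perm12 middle_shading n v f \<longleftrightarrow>
      pattern_occurrence 2 perm12 n v f \<and>
      (\<forall>c\<in>{1..n}. f 1 < c \<longrightarrow> c < f 2 \<longrightarrow>
        \<not> (0 < v c \<and> v c < v (f 1)) \<and> \<not> (v (f 1) < v c \<and> v c < v (f 2)))"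
    by (auto simp: mesh_occurrence_def middle_shading_def grid_line_def perm12_def numeral_2_eq_2)
  also have "\<dots> \<longleftrightarrow> middle_swap n v (f 1) (f 2)"
  proof -
    have "(\<forall>c\<in>{1..n}. f 1 < c \<longrightarrow> c < f 2 \<longrightarrow>
        \<not> (0 < v c \<and> v c < v (f 1)) \<and> \<not> (v (f 1) < v c \<and> v c < v (f 2))) \<longleftrightarrow>
      \<not> (\<exists>c. f 1 < c \<and> c < f 2 \<and> v c < v (f 2))"
      if "f 1 \<in> {1..n}" "f 2 \<in> {1..n}" "v (f 1) < v (f 2)"
    proof -
      \<comment> \<open>The shaded regions are open. Positivity and injectivity keep points off the
        grid lines, so the two regions together forbid every value below
        \<open>v (f 2)\<close>.\<close>
      have "c \<in> {1..n} \<and> 0 < v c \<and> v c \<noteq> v (f 1) \<and> v c \<noteq> v (f 2)" if "f 1 < c" "c < f 2" for c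
        using pos[of c] inj \<open>f 1 \<in> {1..n}\<close> \<open>f 2 \<in> {1..n}\<close> that by auto
      then show ?thesis
        using \<open>v (f 1) < v (f 2)\<close> by (meson linorder_neqE_nat order_less_trans)
    qed
    then show ?thesis
      unfolding pattern_occurrence_2_iff middle_swap_def by blast
  qed
  finally show ?thesis .
qed

lemma mesh_occurrence_perm21_iff:
  assumes v: "v permutes {1..n}"
  shows "mesh_occurrence 2 perm21 middle_shading n v f \<longleftrightarrow>
    f 1 \<in> {1..n} \<and> f 2 \<in> {1..n} \<and> f 1 < f 2 \<and> v (f 2) < v (f 1) \<and>
    \<not> (\<exists>c. f 1 < c \<and> c < f 2 \<and> v c < v (f 1))"
proof -
  have pos: "0 < v c" if "c \<in> {1..n}" for c
    using permutes_in_image[OF v, of c] that by auto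
  have inj: "v c = v d \<longleftrightarrow> c = d" for c d using permutes_inj[OF v] by (simp add: inj_eq)
  \<comment> \<open>The horizontal grid lines use the inverse of the pattern, so
    \<open>v (f 2)\<close> is the lower line and \<open>v (f 1)\<close> the upper.\<close>
  have inv: "inv perm21 = perm21" by (simp add: perm21_def)
  have "mesh_occurrence 2 perm21 middle_shading n v f \<longleftrightarrow>
      pattern_occurrence 2 perm21 n v f \<and>
      (\<forall>c\<in>{1..n}. f 1 < c \<longrightarrow> c < f 2 \<longrightarrow>
        \<not> (0 < v c \<and> v c < v (f 2)) \<and> \<not> (v (f 2) < v c \<and> v c < v (f 1)))"
    by (auto simp: mesh_occurrence_def middle_shading_def grid_line_def inv perm21_def numeral_2_eq_2)
  also have "\<dots> \<longleftrightarrow> f 1 \<in> {1..n} \<and> f 2 \<in> {1..n} \<and> f 1 < f 2 \<and> v (f 2) < v (f 1) \<and>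
      \<not> (\<exists>c. f 1 < c \<and> c < f 2 \<and> v c < v (f 1))"
  proof -
    have "(\<forall>c\<in>{1..n}. f 1 < c \<longrightarrow> c < f 2 \<longrightarrow>
        \<not> (0 < v c \<and> v c < v (f 2)) \<and> \<not> (v (f 2) < v c \<and> v c < v (f 1))) \<longleftrightarrow>
      \<not> (\<exists>c. f 1 < c \<and> c < f 2 \<and> v c < v (f 1))"
      if "f 1 \<in> {1..n}" "f 2 \<in> {1..n}" "v (f 2) < v (f 1)"
    proof -
      have "c \<in> {1..n} \<and> 0 < v c \<and> v c \<noteq> v (f 1) \<and> v c \<noteq> v (f 2)" if "f 1 < c" "c < f 2" for c
        using pos[of c] inj \<open>f 1 \<in> {1..n}\<close> \<open>f 2 \<in> {1..n}\<close> that by auto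
      then show ?thesis
        using \<open>v (f 2) < v (f 1)\<close> by (meson linorder_neqE_nat order_less_trans)
    qed
    then show ?thesis
      unfolding pattern_occurrence_2_iff by blast
  qed
  finally show ?thesis .
qed

text \<open>Bijections that agree off \<open>{a, b}\<close> have the same image of
  \<open>{a, b}\<close>, so they are equal or differ by the swap; \<open>w a \<noteq> v a\<close>
  selects the swap.\<close>

lemma permutes_eq_swap:
  assumes v: "v permutes {1..n}" and w: "w permutes {1..n}" and "a \<noteq> b" "w a \<noteq> v a"
    and eq: "\<And>c. c \<in> {1..n} - {a, b} \<Longrightarrow> w c = v c"
  shows "w = v \<circ> transpose a b"
proof -
  have eq': "w c = v c" if "c \<noteq> a" "c \<noteq> b" for c
    using eq[of c] that v w by (cases "c \<in> {1..n}") (auto simp: permutes_not_in)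
  have injw: "w c = w d \<longleftrightarrow> c = d" for c d using permutes_inj[OF w] by (simp add: inj_eq)
  have "w ` {a, b} = v ` {a, b}"
  proof -
    have "w ` (- {a, b}) = v ` (- {a, b})" using eq' by (intro image_cong) auto
    then show ?thesis
      using permutes_bij[OF v] permutes_bij[OF w] by (metis bij_image_Compl_eq double_compl)
  qed
  moreover have "w a \<noteq> w b" using injw \<open>a \<noteq> b\<close> by simp
  ultimately have "w a = v b" "w b = v a" using \<open>w a \<noteq> v a\<close> by (auto simp: doubleton_eq_iff)
  then show ?thesis using eq' by (auto simp: fun_eq_iff transpose_def)
qed

lemma mesh_swap_iff:
  assumes v: "v permutes {1..n}" and w: "w permutes {1..n}"
  shows "(\<exists>f. mesh_occurrence 2 perm12 middle_shading n v f \<and>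
              mesh_occurrence 2 perm21 middle_shading n w f \<and>
              (\<forall>c\<in>{1..n} - {f 1, f 2}. w c = v c))
    \<longleftrightarrow> (\<exists>a b. middle_swap n v a b \<and> w = v \<circ> transpose a b)"
proof
  assume "\<exists>f. mesh_occurrence 2 perm12 middle_shading n v f \<and>
              mesh_occurrence 2 perm21 middle_shading n w f \<and>
              (\<forall>c\<in>{1..n} - {f 1, f 2}. w c = v c)"
  then obtain f :: "nat \<Rightarrow> nat" where f: "middle_swap n v (f 1) (f 2)" "w (f 2) < w (f 1)"
      "\<And>c. c \<in> {1..n} - {f 1, f 2} \<Longrightarrow> w c = v c"
    unfolding mesh_occurrence_perm12_iff[OF v] mesh_occurrence_perm21_iff[OF w] by blast
  have "w = v \<circ> transpose (f 1) (f 2)"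
  proof (rule permutes_eq_swap[OF v w _ _ f(3)])
    show "f 1 \<noteq> f 2" using f(2) by auto
    show "w (f 1) \<noteq> v (f 1)"
    proof
      \<comment> \<open>Then \<open>w\<close> and \<open>v\<close> agree everywhere except possibly
        at \<open>f 2\<close>, and bijectivity forces agreement there too. But the two entries are
        ascending in \<open>v\<close> and descending in \<open>w\<close>.\<close>
      assume same: "w (f 1) = v (f 1)"
      have out: "w c = v c" if "c \<noteq> f 2" for c
        using that same f(3)[of c] v w by (cases "c \<in> {1..n}") (auto simp: permutes_not_in)
      have "w (f 2) = v (f 2)"
      proof -
        obtain d where d: "v (f 2) = w d" using permutes_surj[OF w] by (metis surjD)
        then show ?thesis using out[of d] permutes_inj[OF v] by (metis injD)
      qed
      then show False using f(1,2) same by (auto simp: middle_swap_def)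
    qed
  qed
  then show "\<exists>a b. middle_swap n v a b \<and> w = v \<circ> transpose a b" using f(1) by blast
next
  assume "\<exists>a b. middle_swap n v a b \<and> w = v \<circ> transpose a b"
  then obtain a b where ab: "middle_swap n v a b" "w = v \<circ> transpose a b" by blast
  \<comment> \<open>Only the values at 1 and 2 matter for a pattern of length two; \<open>b\<close>
    elsewhere is arbitrary.\<close>
  define f where "f t = (if t = 1 then a else b)" for t :: nat
  have [simp]: "f 1 = a" "f (Suc 0) = a" "f 2 = b" by (simp_all add: f_def)
  have "mesh_occurrence 2 perm12 middle_shading n v f"
    using ab by (simp add: mesh_occurrence_perm12_iff[OF v])
  moreover have "mesh_occurrence 2 perm21 middle_shading n w f"
    \<comment> \<open>Entries strictly between \<open>a\<close> and \<open>b\<close> do not move and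
      \<open>w a = v b\<close>, so the shaded region is the same for \<open>v\<close> and
      \<open>w\<close>.\<close>
    unfolding mesh_occurrence_perm21_iff[OF w]
    using ab by (auto simp: middle_swap_def transpose_def)
  moreover have "\<forall>c\<in>{1..n} - {f 1, f 2}. w c = v c"
    using ab(2) by (auto simp: transpose_def)
  ultimately show "\<exists>f. mesh_occurrence 2 perm12 middle_shading n v f \<and>
              mesh_occurrence 2 perm21 middle_shading n w f \<and>
              (\<forall>c\<in>{1..n} - {f 1, f 2}. w c = v c)" by blast
qed

theorem theorem1p9:
  fixes n :: nat and v w :: "nat \<Rightarrow> nat"
  assumes "v \<in> sym_perms n" and "w \<in> sym_perms n"
  shows "(middle_covers n w v \<longleftrightarrow>
            (\<exists>a\<in>{1..n}. \<exists>b\<in>{1..n}. a < b \<and> v a < v b \<and>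
               \<not> (\<exists>c. a < c \<and> c < b \<and> v c < v b) \<and>
               w = v \<circ> transpose a b))
       \<and> (middle_covers n w v \<longleftrightarrow>
            (\<exists>f. mesh_occurrence 2 perm12 middle_shading n v f \<and>
                 mesh_occurrence 2 perm21 middle_shading n w f \<and>
                 (\<forall>c\<in>{1..n} - {f 1, f 2}. w c = v c)))"
proof -
  have v: "v permutes {1..n}" and w: "w permutes {1..n}"
    using assms by (simp_all add: sym_perms_def)
  have "(\<exists>a b. middle_swap n v a b \<and> w = v \<circ> transpose a b) \<longleftrightarrow>
      (\<exists>a\<in>{1..n}. \<exists>b\<in>{1..n}. a < b \<and> v a < v b \<and>
         \<not> (\<exists>c. a < c \<and> c < b \<and> v c < v b) \<and> w = v \<circ> transpose a b)"
    unfolding middle_swap_def by blast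
  then show ?thesis
    using middle_covers_iff_swap[OF v w] mesh_swap_iff[OF v w] by argo
qed

end
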